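(* Let $G=(V,E)$ be a connected locally finite graph with symmetric positive edge weights $w_{xy}=w_{yx}>0$ ($xy\in E$) and positive measure $\mu:V\to(0,+\infty)$, let $O\in V$ be a given vertex, let $p>2$, and let $h:V\to\mathbb{R}$ be a function. For a mass constraint $m>0$ consider the problem $$-\Delta u+\lambda_m h u=u^{p-1}\ \text{ in } V,\qquad u>0\ \text{ in } V,\qquad \int_V h u^2\,d\mu=m. \qquad ( * )$$ Suppose that the following conditions are satisfied: (c1) there is a constant $\mu_{\min}>0$ such that $\mu(x)\ge\mu_{\min}$ for all $x\in V$; (c2) $\inf_{x\in V}h(x)=h_0>0$ and $h(x)\to+\infty$ as $\rho(x)\to\infty$, where $\rho(x)=d(x,O)$; (c3) $\displaystyle h(O)<m\left\{\frac{2}{p}\,\frac{\mu(O)^{2-\frac p2}}{\deg(O)}\right\}^{\frac{2}{p-2}}$, where $m$ is the mass constraint in $( * )$. Suppose also that $u_m\in\mathcal{H}$ is a solution of $( * )$ with mass constraint $m$ and that $\lambda_m\ge -c$ for some constant $c\ge 0$. (i) If $m\to 0^+$, then, up to a subsequence, $v_m=u_m/\sqrt{m}$ converges to a function $v$ uniformly on $V$, where either $v\equiv 0$, or $v$ is a solution of $$-\Delta v=\lambda_0 h v\ \text{ in } V,\qquad 0<\int_V h v^2\,d\mu\le 1$$ for some constant $\lambda_0>0$. In particular, if $c=0$, then $v\equiv 0$ on $V$. (ii) If $m\to+\infty$, then, up to a subsequence, $w_m=u_m/\sqrt{m}$ converges to a function $w$ uniformly on $V$, where either $w\equiv 0$,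 or $w$ is a solution of $$|w|^{p-2}w=\lambda_\infty h w,\qquad\text{where}\quad \lambda_\infty=\frac{\int_V|w|^p\,d\mu}{\int_V h w^2\,d\mu}.$$
   Context: A graph is locally finite if every $x\in V$ has only finitely many $y\in V$ with $xy\in E$. $y\sim x$ means $xy\in E$; $d(x,O)$ is the distance between $x$ and $O$ in the graph; $\deg(x)=\sum_{y\sim x}w_{xy}$. For $u:V\to\mathbb{R}$, $\Delta u(x)=\frac{1}{\mu(x)}\sum_{y\sim x}w_{xy}(u(y)-u(x))$, $|\nabla u|^2(x)=\frac{1}{2\mu(x)}\sum_{y\sim x}w_{xy}(u(y)-u(x))^2$, and $\int_V u\,d\mu=\sum_{x\in V}\mu(x)u(x)$. $C_c(V)$ is the set of functions $V\to\mathbb{R}$ with finite support; $H_0(V)$ is the completion of $C_c(V)$ under the norm $\|u\|_{H_0}=\left(\int_V(|\nabla u|^2+u^2)\,d\mu\right)^{1/2}$; and $\mathcal{H}=\{u\in H_0(V):\int_V(|\nabla u|^2+hu^2)\,d\mu<+\infty\}$. The real number $\lambda_m$ is the Lagrange multiplier corresponding to $u_m$ and is not prescribed. *)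

theory Defs
  imports "HOL-Analysis.Analysis"
begin

text \<open>The vertex set V is the whole type \<open>'v\<close>; E is the adjacency relation, so \<open>(x, y) \<in> E\<close> means
  that xy is an edge.  The weight wt is constrained (and used) on edges only.\<close>

locale weighted_graph =
  fixes E :: "'v rel" and wt :: "'v \<Rightarrow> 'v \<Rightarrow> real" and \<mu> :: "'v \<Rightarrow> real"
  assumes sym_edges: "sym E"
    and no_loops: "irrefl E"
    and locally_finite: "finite {y. (x, y) \<in> E}"
    and connected_graph: "(x, y) \<in> E\<^sup>*"
    and wt_sym: "(x, y) \<in> E \<Longrightarrow> wt x y = wt y x"
    and wt_pos: "(x, y) \<in> E \<Longrightarrow> wt x y > 0"
    and measure_pos: "\<mu> x > 0"

definition graph_dist :: "'v rel \<Rightarrow> 'v \<Rightarrow> 'v \<Rightarrow> nat" where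
  "graph_dist E x y = (LEAST n. (x, y) \<in> E ^^ n)"

definition wdeg :: "'v rel \<Rightarrow> ('v \<Rightarrow> 'v \<Rightarrow> real) \<Rightarrow> 'v \<Rightarrow> real" where
  "wdeg E wt x = (\<Sum>y | (x, y) \<in> E. wt x y)"

definition laplacian ::
    "'v rel \<Rightarrow> ('v \<Rightarrow> 'v \<Rightarrow> real) \<Rightarrow> ('v \<Rightarrow> real) \<Rightarrow> ('v \<Rightarrow> real) \<Rightarrow> 'v \<Rightarrow> real" where
  "laplacian E wt \<mu> u x = 1 / \<mu> x * (\<Sum>y | (x, y) \<in> E. wt x y * (u y - u x))"

definition grad_sq ::
    "'v rel \<Rightarrow> ('v \<Rightarrow> 'v \<Rightarrow> real) \<Rightarrow> ('v \<Rightarrow> real) \<Rightarrow> ('v \<Rightarrow> real) \<Rightarrow> 'v \<Rightarrow> real" where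
  "grad_sq E wt \<mu> u x = 1 / (2 * \<mu> x) * (\<Sum>y | (x, y) \<in> E. wt x y * (u y - u x)\<^sup>2)"

text \<open>\<open>infsum\<close> is 0 on families that are not summable, so finiteness of an integral is always
  expressed separately, by \<open>V_integrable\<close>.\<close>

definition V_integrable :: "('v \<Rightarrow> real) \<Rightarrow> ('v \<Rightarrow> real) \<Rightarrow> bool" where
  "V_integrable \<mu> f \<longleftrightarrow> (\<lambda>x. \<mu> x * f x) summable_on UNIV"

definition V_integral :: "('v \<Rightarrow> real) \<Rightarrow> ('v \<Rightarrow> real) \<Rightarrow> real" where
  "V_integral \<mu> f = (\<Sum>\<^sub>\<infinity>x. \<mu> x * f x)"

definition Cc :: "('v \<Rightarrow> real) set" where
  "Cc = {u. finite {x. u x \<noteq> 0}}"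

definition H0_norm ::
    "'v rel \<Rightarrow> ('v \<Rightarrow> 'v \<Rightarrow> real) \<Rightarrow> ('v \<Rightarrow> real) \<Rightarrow> ('v \<Rightarrow> real) \<Rightarrow> real" where
  "H0_norm E wt \<mu> u = sqrt (V_integral \<mu> (\<lambda>x. grad_sq E wt \<mu> u x + (u x)\<^sup>2))"

text \<open>The completion of \<open>Cc\<close> as a space of functions.  Since \<open>\<mu> x * (u x)\<^sup>2 \<le> (H0_norm E wt \<mu> u)\<^sup>2\<close>,
  Cauchy sequences converge pointwise, and (Fatou) the functions of finite norm form a Hilbert
  space; the completion is therefore the closure of \<open>Cc\<close> in that space.\<close>

definition H0 ::
    "'v rel \<Rightarrow> ('v \<Rightarrow> 'v \<Rightarrow> real) \<Rightarrow> ('v \<Rightarrow> real) \<Rightarrow> ('v \<Rightarrow> real) set" where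
  "H0 E wt \<mu> = {u. V_integrable \<mu> (\<lambda>x. grad_sq E wt \<mu> u x + (u x)\<^sup>2) \<and>
     (\<exists>\<phi>. (\<forall>n. \<phi> n \<in> Cc) \<and> (\<lambda>n. H0_norm E wt \<mu> (\<lambda>x. \<phi> n x - u x)) \<longlonglongrightarrow> 0)}"

definition H_space ::
    "'v rel \<Rightarrow> ('v \<Rightarrow> 'v \<Rightarrow> real) \<Rightarrow> ('v \<Rightarrow> real) \<Rightarrow> ('v \<Rightarrow> real) \<Rightarrow> ('v \<Rightarrow> real) set" where
  "H_space E wt \<mu> h =
     {u \<in> H0 E wt \<mu>. V_integrable \<mu> (\<lambda>x. grad_sq E wt \<mu> u x + h x * (u x)\<^sup>2)}"

definition mass_solution ::
    "'v rel \<Rightarrow> ('v \<Rightarrow> 'v \<Rightarrow> real) \<Rightarrow> ('v \<Rightarrow> real) \<Rightarrow> real \<Rightarrow> ('v \<Rightarrow> real) \<Rightarrow> real \<Rightarrow> real \<Rightarrow>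
      ('v \<Rightarrow> real) \<Rightarrow> bool" where
  "mass_solution E wt \<mu> p h m lam u \<longleftrightarrow>
     (\<forall>x. - laplacian E wt \<mu> u x + lam * h x * u x = u x powr (p - 1)) \<and>
     (\<forall>x. u x > 0) \<and>
     V_integrable \<mu> (\<lambda>x. h x * (u x)\<^sup>2) \<and>
     V_integral \<mu> (\<lambda>x. h x * (u x)\<^sup>2) = m"

text \<open>Pitfall: for fixed h with h x0 positive this forces a lower bound on m, so it cannot hold along
  masses tending to 0.  If \<open>wdeg E wt x0 = 0\<close> (in a connected graph: a single vertex), division by
  zero makes it false for positive h x0.\<close>

definition mass_condition ::
    "'v rel \<Rightarrow> ('v \<Rightarrow> 'v \<Rightarrow> real) \<Rightarrow> ('v \<Rightarrow> real) \<Rightarrow> 'v \<Rightarrow> real \<Rightarrow> ('v \<Rightarrow> real) \<Rightarrow> real \<Rightarrow> bool" where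
  "mass_condition E wt \<mu> x0 p h m \<longleftrightarrow>
     h x0 < m * (2 / p * (\<mu> x0 powr (2 - p / 2) / wdeg E wt x0)) powr (2 / (p - 2))"

end

theory Submission
  imports Defs "HOL-Complex_Analysis.Great_Picard"
begin

text \<open>
  The mass constraint and the growth of \<open>h\<close> give compactness; the equation is then passed to the
  limit vertex by vertex.

  Put \<open>v\<^sub>k = u\<^sub>k / sqrt m\<^sub>k\<close>.  The normalised mass
  \<open>\<Sum>\<^sub>\<infinity>x. \<mu> x * h x * (v\<^sub>k x)\<^sup>2 = 1\<close> bounds every single term of the sum, so
  \<open>v\<^sub>k x \<le> 1 / sqrt (\<mu>min * h x)\<close>, uniformly in \<open>k\<close>.  Balls of a locally finite graph are
  finite, hence so are the sublevel sets of \<open>h\<close>, and the bound tends to zero along the vertex set.  A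
  diagonal argument on the countably many vertices thus yields a subsequence that converges
  uniformly (\<open>dominated_uniform_subsequence\<close>); Fatou's lemma, applied to finite partial sums, shows
  that the mass of the limit \<open>w\<close> is at most one (\<open>normalised_subsequence\<close>).

  Division of the equation by \<open>sqrt m\<^sub>k\<close> gives
  \<open>-\<Delta>v\<^sub>k + \<lambda>\<^sub>k h v\<^sub>k = m\<^sub>k powr ((p - 2) / 2) * v\<^sub>k powr (p - 1)\<close>.  For masses tending to zero
  the right-hand side disappears; for masses tending to infinity the equation is divided by the
  power of \<open>m\<^sub>k\<close> once more, and it is the Laplacian that disappears.  In both cases a vertex at which \<open>w\<close>
  does not vanish allows the equation there to be solved for the multiplier (rescaled in the
  second case).  So the multiplier converges, although it was only bounded from below
  (\<open>multiplier_limit\<close>), and the limit equation holds everywhere.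

  For large masses the limit equation is \<open>w powr (p - 1) = \<lambda> h w\<close>; multiplied by \<open>w\<close> and summed it
  identifies \<open>\<lambda>\<close> as the stated quotient.  For small masses it is \<open>-\<Delta>w = \<lambda>\<^sub>0 h w\<close> with \<open>\<lambda>\<^sub>0\<close> the
  limit of \<open>-\<lambda>\<^sub>k \<le> c\<close>.  Positivity of \<open>\<lambda>\<^sub>0\<close> comes from the strong maximum principle
  (\<open>eigenvalue_positive\<close>): otherwise the nonnegative function \<open>w\<close>, which vanishes at infinity, would be subharmonic
  and attain its maximum, so it would be a nonzero constant on an infinite graph.  For \<open>c = 0\<close> this
  contradicts \<open>\<lambda>\<^sub>0 \<le> c\<close>.  On a finite graph constants survive this argument, but there the mass
  condition is available, and it bounds the masses away from zero: small masses do not occur.\<close>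

section \<open>Uniform compactness under a vanishing bound\<close>

text \<open>A bound that vanishes at infinity along the index set forces all but countably many values
  to be zero, which permits a diagonal subsequence, and it makes the tails uniformly small, which
  upgrades pointwise to uniform convergence.\<close>

lemma dominated_uniform_subsequence:
  fixes f :: "nat \<Rightarrow> 'a \<Rightarrow> real"
  assumes bound: "\<And>n x. \<bar>f n x\<bar> \<le> B x"
    and vanish: "\<And>e. e > 0 \<Longrightarrow> finite {x. B x \<ge> e}"
  obtains r g where "strict_mono (r :: nat \<Rightarrow> nat)"
    "uniform_limit UNIV (\<lambda>k. f (r k)) g sequentially"
proof -
  define S where "S = {x. B x > 0}"
  have "S \<subseteq> (\<Union>n. {x. B x \<ge> inverse (real (Suc n))})"
  proof
    fix x assume "x \<in> S"
    then have "B x > 0"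
      by (simp add: S_def)
    from reals_Archimedean[OF this] obtain n where "inverse (real (Suc n)) < B x" ..
    then show "x \<in> (\<Union>n. {x. B x \<ge> inverse (real (Suc n))})"
      by (blast intro: less_imp_le)
  qed
  moreover have "countable (\<Union>n. {x. B x \<ge> inverse (real (Suc n))})"
    by (intro countable_UN[OF countableI_type] countable_finite vanish) simp
  ultimately have "countable S"
    by (rule countable_subset)
  have "bdd_above (B ` {x. B x \<ge> 1})"
    using vanish[of 1] by simp
  then obtain C where C: "\<And>x. B x \<ge> 1 \<Longrightarrow> B x \<le> C"
    by (auto simp: bdd_above_def)
  have "norm (f n x) \<le> max 1 C" for n x
    using bound[of n x] C[of x] by (cases "B x \<ge> 1") auto
  then obtain r where r: "strict_mono (r :: nat \<Rightarrow> nat)"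
      and conv: "\<And>x. x \<in> S \<Longrightarrow> \<exists>l. (\<lambda>n. f (r n) x) \<longlonglongrightarrow> l"
    using function_convergent_subsequence[OF \<open>countable S\<close>, of f "max 1 C"] by metis
  have "\<exists>l. (\<lambda>n. f (r n) x) \<longlonglongrightarrow> l" for x
  proof (cases "x \<in> S")
    case False
    then have "f n x = 0" for n
      using bound[of n x] by (simp add: S_def)
    then show ?thesis
      by (auto intro: tendsto_const)
  qed (rule conv)
  then obtain g where g: "\<And>x. (\<lambda>n. f (r n) x) \<longlonglongrightarrow> g x"
    by metis
  have g_bound: "\<bar>g x\<bar> \<le> B x" for x
    using tendsto_rabs[OF g[of x]] by (rule LIMSEQ_le_const2) (use bound in auto)
  have "uniform_limit UNIV (\<lambda>k. f (r k)) g sequentially"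
  proof (rule uniform_limitI)
    fix e :: real assume "e > 0"
    have "\<forall>\<^sub>F n in sequentially. \<forall>x\<in>{x. B x \<ge> e / 2}. dist (f (r n) x) (g x) < e"
      by (rule eventually_ball_finite)
        (use vanish[of "e / 2"] \<open>e > 0\<close> in \<open>auto intro: tendstoD[OF g]\<close>)
    then show "\<forall>\<^sub>F n in sequentially. \<forall>x\<in>UNIV. dist (f (r n) x) (g x) < e"
    proof eventually_elim
      case (elim n)
      have "dist (f (r n) x) (g x) < e" if "B x < e / 2" for x
        using bound[of "r n" x] g_bound[of x] that by (auto simp: dist_real_def)
      with elim show ?case
        by (metis (mono_tags, lifting) mem_Collect_eq not_le_imp_less)
    qed
  qed
  with r show thesis
    by (rule that)
qed

section \<open>Scaling and lower semicontinuity of the mass\<close>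

lemma laplacian_divide: "laplacian E wt \<mu> (\<lambda>x. u x / s) x = laplacian E wt \<mu> u x / s"
proof -
  have "wt x y * (u y / s - u x / s) = wt x y * (u y - u x) / s" for y
    by (simp flip: diff_divide_distrib)
  then show ?thesis
    by (simp add: laplacian_def flip: sum_divide_distrib)
qed

lemma laplacian_tendsto:
  assumes "\<And>x. (\<lambda>k. v k x) \<longlonglongrightarrow> w x"
  shows "(\<lambda>k. laplacian E wt \<mu> (v k) x) \<longlonglongrightarrow> laplacian E wt \<mu> w x"
  unfolding laplacian_def by (intro tendsto_intros assms)

text \<open>The nonlinearity is homogeneous of degree \<open>p - 1\<close>, the rest of the equation of degree one;
  the excess is the power of \<open>m\<close> on the right.\<close>

lemma mass_solution_rescaled_equation:
  assumes "mass_solution E wt \<mu> p h m lam u" "m > 0"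
  shows "- laplacian E wt \<mu> (\<lambda>x. u x / sqrt m) x + lam * h x * (u x / sqrt m)
    = m powr ((p - 2) / 2) * (u x / sqrt m) powr (p - 1)"
proof -
  have "u x powr (p - 1) = - laplacian E wt \<mu> u x + lam * h x * u x" and "u x > 0"
    using assms by (auto simp: mass_solution_def)
  then have "- laplacian E wt \<mu> (\<lambda>x. u x / sqrt m) x + lam * h x * (u x / sqrt m)
      = u x powr (p - 1) / sqrt m"
    by (simp add: laplacian_divide diff_divide_distrib)
  also have "u x powr (p - 1) = (sqrt m) powr (p - 1) * (u x / sqrt m) powr (p - 1)"
    using assms(2) \<open>u x > 0\<close> by (simp flip: powr_mult)
  also have "(sqrt m) powr (p - 1) = m powr ((p - 2) / 2) * sqrt m"
  proof -
    have "(sqrt m) powr (p - 1) = m powr ((p - 2) / 2 + 1 / 2)"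
      using assms(2) by (simp add: powr_half_sqrt[symmetric] powr_powr diff_divide_distrib)
    then show ?thesis
      using assms(2) by (simp only: powr_add powr_half_sqrt less_imp_le)
  qed
  finally show ?thesis
    using assms(2) by simp
qed

lemma mass_solution_rescaled_partial_mass:
  assumes "mass_solution E wt \<mu> p h m lam u" "m > 0" "finite F"
    and "\<And>x. \<mu> x \<ge> 0" "\<And>x. h x \<ge> 0"
  shows "(\<Sum>x\<in>F. \<mu> x * (h x * (u x / sqrt m)\<^sup>2)) \<le> 1"
proof -
  have "(\<Sum>x\<in>F. \<mu> x * (h x * (u x)\<^sup>2)) \<le> (\<Sum>\<^sub>\<infinity>x. \<mu> x * (h x * (u x)\<^sup>2))"
    by (rule finite_sum_le_infsum)
      (use assms in \<open>auto simp: mass_solution_def V_integrable_def\<close>)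
  also have "\<dots> = m"
    using assms(1) by (simp add: mass_solution_def V_integral_def)
  finally have "(\<Sum>x\<in>F. \<mu> x * (h x * (u x)\<^sup>2)) / m \<le> 1"
    using assms(2) by simp
  then show ?thesis
    using assms(2) by (simp add: power_divide sum_divide_distrib)
qed

text \<open>Fatou's lemma, in the form in which a bound on all finite partial sums passes to the limit.\<close>

lemma V_integral_le_of_limit:
  fixes v :: "nat \<Rightarrow> 'v \<Rightarrow> real"
  assumes lim: "\<And>x. (\<lambda>k. v k x) \<longlonglongrightarrow> w x"
    and partial: "\<And>k F. finite F \<Longrightarrow> (\<Sum>x\<in>F. \<mu> x * (h x * (v k x)\<^sup>2)) \<le> C"
    and "\<And>x. \<mu> x \<ge> 0" "\<And>x. h x \<ge> 0"
  shows "V_integrable \<mu> (\<lambda>x. h x * (w x)\<^sup>2)" and "V_integral \<mu> (\<lambda>x. h x * (w x)\<^sup>2) \<le> C"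
proof -
  have sums: "(\<Sum>x\<in>F. \<mu> x * (h x * (w x)\<^sup>2)) \<le> C" if "finite F" for F
  proof (rule LIMSEQ_le_const2)
    show "(\<lambda>k. \<Sum>x\<in>F. \<mu> x * (h x * (v k x)\<^sup>2)) \<longlonglongrightarrow> (\<Sum>x\<in>F. \<mu> x * (h x * (w x)\<^sup>2))"
      by (intro tendsto_intros lim)
  qed (use partial that in blast)
  show "V_integrable \<mu> (\<lambda>x. h x * (w x)\<^sup>2)"
    unfolding V_integrable_def
    by (rule nonneg_bdd_above_summable_on) (use assms sums in \<open>auto simp: bdd_above_def\<close>)
  then show "V_integral \<mu> (\<lambda>x. h x * (w x)\<^sup>2) \<le> C"
    unfolding V_integrable_def V_integral_def by (rule infsum_le_finite_sums) (use sums in auto)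
qed

lemma V_integral_pos:
  assumes "V_integrable \<mu> f" "\<And>x. \<mu> x > 0" "\<And>x. f x \<ge> 0" "f z > 0"
  shows "V_integral \<mu> f > 0"
proof -
  have "0 < (\<Sum>x\<in>{z}. \<mu> x * f x)"
    using assms by simp
  also have "\<dots> \<le> V_integral \<mu> f"
    unfolding V_integral_def
    by (rule finite_sum_le_infsum)
      (use assms in \<open>auto simp: V_integrable_def intro: mult_nonneg_nonneg less_imp_le\<close>)
  finally show ?thesis .
qed

section \<open>Convergence of the Lagrange multipliers\<close>

text \<open>At a vertex where the limit function does not vanish, the equation determines the multiplier
  \<open>l k\<close> as a quotient of convergent quantities.  The two coefficients \<open>a\<close> and \<open>b\<close> allow one
  statement to serve both regimes: in one the nonlinearity is switched off in the limit, in the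
  other the Laplacian.\<close>

lemma multiplier_limit:
  assumes lim: "\<And>x. (\<lambda>k. v k x) \<longlonglongrightarrow> w x"
    and nonneg: "\<And>k x. v k x \<ge> (0 :: real)"
    and "q > 0" and a: "a \<longlonglongrightarrow> A" and b: "b \<longlonglongrightarrow> B"
    and eq: "\<And>k x. - (a k * laplacian E wt \<mu> (v k) x) + l k * h x * v k x = b k * v k x powr q"
    and "h z \<noteq> 0" "w z \<noteq> 0"
  obtains L where "l \<longlonglongrightarrow> L"
    "\<And>x. - (A * laplacian E wt \<mu> w x) + L * h x * w x = B * w x powr q"
proof -
  have pow: "(\<lambda>k. v k x powr q) \<longlonglongrightarrow> w x powr q" for x
    by (rule tendsto_powr'[OF lim tendsto_const]) (use nonneg \<open>q > 0\<close> in auto)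
  note lap = laplacian_tendsto[of v w E wt \<mu>, OF lim]
  define L where "L = (B * w z powr q + A * laplacian E wt \<mu> w z) / (h z * w z)"
  have "(\<lambda>k. (b k * v k z powr q + a k * laplacian E wt \<mu> (v k) z) / (h z * v k z)) \<longlonglongrightarrow> L"
    unfolding L_def by (intro tendsto_intros a b pow lap lim) (use assms in auto)
  moreover have "\<forall>\<^sub>F k in sequentially.
      (b k * v k z powr q + a k * laplacian E wt \<mu> (v k) z) / (h z * v k z) = l k"
    using tendsto_imp_eventually_ne[OF lim \<open>w z \<noteq> 0\<close>]
  proof eventually_elim
    case (elim k)
    then show ?case
      using eq[of k z, symmetric] \<open>h z \<noteq> 0\<close> by simp
  qed
  ultimately have l: "l \<longlonglongrightarrow> L"
    by (rule Lim_transform_eventually)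
  have "- (A * laplacian E wt \<mu> w x) + L * h x * w x = B * w x powr q" for x
  proof (rule LIMSEQ_unique)
    show "(\<lambda>k. - (a k * laplacian E wt \<mu> (v k) x) + l k * h x * v k x)
        \<longlonglongrightarrow> - (A * laplacian E wt \<mu> w x) + L * h x * w x"
      by (intro tendsto_intros a l lap lim)
    show "(\<lambda>k. - (a k * laplacian E wt \<mu> (v k) x) + l k * h x * v k x) \<longlonglongrightarrow> B * w x powr q"
      unfolding eq by (intro tendsto_intros b pow)
  qed
  with l show thesis
    by (rule that)
qed

context weighted_graph
begin

section \<open>Finite balls and the maximum principle\<close>

lemma finite_walk_sources: "finite {x. (x, z) \<in> E ^^ n}"
proof (induction n)
  case (Suc n)
  have "{x. (x, z) \<in> E ^^ Suc n} \<subseteq> (\<Union>y\<in>{y. (y, z) \<in> E ^^ n}. {x. (y, x) \<in> E})"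
    using sym_edges by (auto dest!: relpow_Suc_D2 dest: symD simp del: relpow.simps)
  then show ?case
    by (rule finite_subset) (use Suc locally_finite in auto)
qed simp

lemma finite_ball: "finite {x. graph_dist E x z < n}"
proof -
  have "(x, z) \<in> E ^^ graph_dist E x z" for x
    using connected_graph[of x z] unfolding graph_dist_def
    by (metis LeastI rtrancl_imp_relpow)
  then have "{x. graph_dist E x z < n} \<subseteq> (\<Union>i<n. {x. (x, z) \<in> E ^^ i})"
    by auto
  then show ?thesis
    by (rule finite_subset) (use finite_walk_sources in auto)
qed

lemma finite_sublevel:
  fixes h :: "'v \<Rightarrow> real"
  assumes "filterlim h at_top (filtercomap (\<lambda>x. graph_dist E x z) at_top)"
  shows "finite {x. h x \<le> M}"
proof -
  obtain N where "\<And>x. graph_dist E x z \<ge> N \<Longrightarrow> h x > M"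
    using assms by (auto simp: filterlim_at_top_dense eventually_filtercomap_at_top_linorder)
  then have "{x. h x \<le> M} \<subseteq> {x. graph_dist E x z < N}"
    by (force simp: not_le[symmetric])
  then show ?thesis
    using finite_ball by (rule finite_subset)
qed

text \<open>At a maximum every summand of the Laplacian is nonpositive, so subharmonicity makes all of
  them vanish: the set where the maximum is attained is closed under taking neighbours.\<close>

lemma strong_maximum_principle:
  assumes sub: "\<And>x. laplacian E wt \<mu> w x \<ge> 0" and max: "\<And>x. w x \<le> w z"
  shows "w y = w z"
proof -
  have step: "w y = w z" if x: "w x = w z" and e: "(x, y) \<in> E" for x y
  proof -
    have "(\<Sum>y | (x, y) \<in> E. wt x y * (w x - w y)) = - (\<Sum>y | (x, y) \<in> E. wt x y * (w y - w x))"
      by (simp add: right_diff_distrib sum_subtractf)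
    also have "\<dots> \<le> 0"
      using sub[of x] measure_pos[of x] by (simp add: laplacian_def zero_le_divide_iff not_less)
    finally have "(\<Sum>y | (x, y) \<in> E. wt x y * (w x - w y)) \<le> 0" .
    moreover have terms: "wt x y * (w x - w y) \<ge> 0" if "(x, y) \<in> E" for y
      using wt_pos[OF that] max[of y] x by simp
    ultimately have "(\<Sum>y | (x, y) \<in> E. wt x y * (w x - w y)) = 0"
      by (intro antisym sum_nonneg) auto
    then have "wt x y * (w x - w y) = 0"
      using terms e locally_finite by (subst (asm) sum_nonneg_eq_0_iff) auto
    then show ?thesis
      using wt_pos[OF e] x by simp
  qed
  from connected_graph[of z y] show ?thesis
    by (induction rule: rtrancl_induct) (auto intro: step)
qed

text \<open>If \<open>L \<le> 0\<close>, the equation makes \<open>w\<close> subharmonic.  Being small outside finite sets it attains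
  its maximum, hence it is a positive constant, which is impossible on an infinite vertex set.\<close>

lemma eigenvalue_positive:
  assumes inf: "infinite (UNIV :: 'v set)"
    and nonneg: "\<And>x. w x \<ge> 0" and vanish: "\<And>e. e > 0 \<Longrightarrow> finite {x. w x \<ge> e}"
    and "w z > 0" and h: "\<And>x. h x > 0"
    and eq: "\<And>x. - laplacian E wt \<mu> w x = L * h x * w x"
  shows "L > 0"
proof (rule ccontr)
  assume "\<not> L > 0"
  define S where "S = {x. w x \<ge> w z}"
  have S: "finite S" "z \<in> S"
    using vanish \<open>w z > 0\<close> by (auto simp: S_def)
  have "Max (w ` S) \<in> w ` S"
    using S by (intro Max_in) auto
  then obtain t where t: "t \<in> S" "w t = Max (w ` S)"
    by force
  have max: "w x \<le> w t" for x
  proof (cases "x \<in> S")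
    case True
    with S t show ?thesis by simp
  next
    case False
    with t show ?thesis by (simp add: S_def)
  qed
  have "laplacian E wt \<mu> w x \<ge> 0" for x
  proof -
    have "L * (h x * w x) \<le> 0"
      using \<open>\<not> L > 0\<close> h[of x] nonneg[of x] by (intro mult_nonpos_nonneg) auto
    then show ?thesis
      using eq[of x] by (simp add: mult.assoc)
  qed
  from strong_maximum_principle[of w t, OF this max] have const: "w x = w t" for x .
  have "x \<in> S" for x
    using t(1) const[of x] by (simp add: S_def)
  then have "S = UNIV" by blast
  with S inf show False by simp
qed

section \<open>Normalised solutions\<close>

text \<open>A single term of the mass sum is at most one, hence \<open>u k x / sqrt (m k)\<close> is bounded by
  \<open>1 / sqrt (\<mu>min * h x)\<close>, which is small off the finite sublevel sets of \<open>h\<close>.  The limit inherits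
  this decay, while of the mass only an upper bound survives, since mass may escape to infinity.\<close>

lemma normalised_subsequence:
  fixes u :: "nat \<Rightarrow> 'v \<Rightarrow> real"
  assumes "\<mu>min > 0" and \<mu>: "\<And>x. \<mu> x \<ge> \<mu>min" and h: "\<And>x. h x > 0"
    and sublevel: "\<And>M. finite {x. h x \<le> M}"
    and m: "\<And>k. m k > 0" and sol: "\<And>k. mass_solution E wt \<mu> p h (m k) (lam k) (u k)"
  obtains r w where "strict_mono (r :: nat \<Rightarrow> nat)"
    "uniform_limit UNIV (\<lambda>k x. u (r k) x / sqrt (m (r k))) w sequentially"
    "\<And>x. w x \<ge> 0" "\<And>e. e > 0 \<Longrightarrow> finite {x. w x \<ge> e}"
    "V_integrable \<mu> (\<lambda>x. h x * (w x)\<^sup>2)" "V_integral \<mu> (\<lambda>x. h x * (w x)\<^sup>2) \<le> 1"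
proof -
  define v where "v k x = u k x / sqrt (m k)" for k x
  define B where "B x = 1 / sqrt (\<mu>min * h x)" for x
  have v_pos: "v k x > 0" for k x
    using sol[of k] m[of k] by (simp add: v_def mass_solution_def)
  have partial: "(\<Sum>x\<in>F. \<mu> x * (h x * (v k x)\<^sup>2)) \<le> 1" if "finite F" for k F
    unfolding v_def
    by (rule mass_solution_rescaled_partial_mass[OF sol m that])
      (use measure_pos h in \<open>auto intro: less_imp_le\<close>)
  have bound: "\<bar>v k x\<bar> \<le> B x" for k x
  proof -
    have "\<mu>min * h x * (v k x)\<^sup>2 \<le> \<mu> x * (h x * (v k x)\<^sup>2)"
      using \<mu>[of x] h[of x] by (simp add: mult.assoc mult_right_mono)
    also have "\<dots> \<le> 1"
      using partial[of "{x}" k] by simp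
    finally have "sqrt (\<mu>min * h x * (v k x)\<^sup>2) \<le> 1"
      by simp
    then show ?thesis
      using v_pos[of k x] h[of x] \<open>\<mu>min > 0\<close> by (simp add: B_def real_sqrt_mult field_simps)
  qed
  have vanish: "finite {x. B x \<ge> e}" if "e > 0" for e
  proof (rule finite_subset)
    show "{x. B x \<ge> e} \<subseteq> {x. h x \<le> (1 / e)\<^sup>2 / \<mu>min}"
    proof clarify
      fix x assume "B x \<ge> e"
      have pos: "\<mu>min * h x > 0"
        using h[of x] \<open>\<mu>min > 0\<close> by simp
      with \<open>B x \<ge> e\<close> \<open>e > 0\<close> have "sqrt (\<mu>min * h x) \<le> 1 / e"
        by (simp add: B_def field_simps)
      then have "\<mu>min * h x \<le> (1 / e)\<^sup>2"
        by (rule sqrt_le_D)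
      then show "h x \<le> (1 / e)\<^sup>2 / \<mu>min"
        using \<open>\<mu>min > 0\<close> by (simp add: pos_le_divide_eq mult.commute)
    qed
  qed (rule sublevel)
  obtain r w where r: "strict_mono (r :: nat \<Rightarrow> nat)"
      and w: "uniform_limit UNIV (\<lambda>k. v (r k)) w sequentially"
    using dominated_uniform_subsequence[of v B, OF bound vanish] .
  have lim: "(\<lambda>k. v (r k) x) \<longlonglongrightarrow> w x" for x
    using tendsto_uniform_limitI[OF w] by simp
  have w_bound: "w x \<le> B x" for x
    using lim by (rule LIMSEQ_le_const2) (use bound abs_le_D1 in blast)
  have unif: "uniform_limit UNIV (\<lambda>k x. u (r k) x / sqrt (m (r k))) w sequentially"
    using w by (simp add: v_def[abs_def])
  have nonneg: "w x \<ge> 0" for x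
  proof (rule LIMSEQ_le_const[OF lim[of x]])
    show "\<exists>N. \<forall>n\<ge>N. 0 \<le> v (r n) x"
      using v_pos by (auto intro: less_imp_le)
  qed
  have decay: "finite {x. w x \<ge> e}" if "e > 0" for e
  proof (rule finite_subset[OF _ vanish[OF that]])
    show "{x. w x \<ge> e} \<subseteq> {x. B x \<ge> e}"
      by (rule Collect_mono) (use w_bound in \<open>metis order_trans\<close>)
  qed
  have mass: "V_integrable \<mu> (\<lambda>x. h x * (w x)\<^sup>2)" "V_integral \<mu> (\<lambda>x. h x * (w x)\<^sup>2) \<le> 1"
    by (rule V_integral_le_of_limit[of "\<lambda>k. v (r k)", OF lim partial];
        use measure_pos h less_imp_le in blast)+
  show thesis
    by (rule that[OF r unif nonneg decay mass])
qed

text \<open>The factor \<open>m k powr ((p - 2) / 2)\<close> tends to zero and linearises the equation.  With \<open>L\<close> the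
  limit of the multipliers, the eigenvalue is \<open>- L\<close>: it is at most \<open>c\<close> by the lower bound on the
  multipliers and positive by the maximum principle, and these two collide when \<open>c = 0\<close>.\<close>

lemma small_mass_limit:
  fixes u :: "nat \<Rightarrow> 'v \<Rightarrow> real"
  assumes inf: "infinite (UNIV :: 'v set)" and "p > 2"
    and "\<mu>min > 0" and \<mu>: "\<And>x. \<mu> x \<ge> \<mu>min" and h: "\<And>x. h x > 0"
    and sublevel: "\<And>M. finite {x. h x \<le> M}"
    and m: "\<And>k. m k > 0" and sol: "\<And>k. mass_solution E wt \<mu> p h (m k) (lam k) (u k)"
    and lam: "\<And>k. lam k \<ge> - c" and m0: "m \<longlonglongrightarrow> 0"
  shows "\<exists>r v. strict_mono r \<and>
    uniform_limit UNIV (\<lambda>k x. u (r k) x / sqrt (m (r k))) v sequentially \<and>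
    ((\<forall>x. v x = 0) \<or>
     (\<exists>lam0>0. (\<forall>x. - laplacian E wt \<mu> v x = lam0 * h x * v x) \<and>
        V_integrable \<mu> (\<lambda>x. h x * (v x)\<^sup>2) \<and>
        0 < V_integral \<mu> (\<lambda>x. h x * (v x)\<^sup>2) \<and>
        V_integral \<mu> (\<lambda>x. h x * (v x)\<^sup>2) \<le> 1)) \<and>
    (c = 0 \<longrightarrow> (\<forall>x. v x = 0))"
proof -
  obtain r v where r: "strict_mono (r :: nat \<Rightarrow> nat)"
    and unif: "uniform_limit UNIV (\<lambda>k x. u (r k) x / sqrt (m (r k))) v sequentially"
    and nonneg: "\<And>x. v x \<ge> 0" and vanish: "\<And>e. e > 0 \<Longrightarrow> finite {x. v x \<ge> e}"
    and mass: "V_integrable \<mu> (\<lambda>x. h x * (v x)\<^sup>2)" "V_integral \<mu> (\<lambda>x. h x * (v x)\<^sup>2) \<le> 1"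
    using normalised_subsequence[of \<mu>min h m p lam u, OF \<open>\<mu>min > 0\<close> \<mu> h sublevel m sol]
    by blast
  have eigenvalue: "\<exists>lam0>0. lam0 \<le> c \<and> (\<forall>x. - laplacian E wt \<mu> v x = lam0 * h x * v x) \<and>
      0 < V_integral \<mu> (\<lambda>x. h x * (v x)\<^sup>2)" if nonzero: "\<not> (\<forall>x. v x = 0)"
  proof -
    obtain z where z: "v z \<noteq> 0"
      using nonzero by blast
    have lim: "(\<lambda>k. u (r k) x / sqrt (m (r k))) \<longlonglongrightarrow> v x" for x
      using tendsto_uniform_limitI[OF unif] by simp
    have power: "(\<lambda>k. m (r k) powr ((p - 2) / 2)) \<longlonglongrightarrow> 0"
      using tendsto_powr'[OF LIMSEQ_subseq_LIMSEQ[OF m0 r] tendsto_const, of "(p - 2) / 2"]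
        \<open>p > 2\<close> m by (auto simp: o_def less_imp_le)
    have v_nonneg: "u (r k) x / sqrt (m (r k)) \<ge> 0" for k x
      using sol[of "r k"] m[of "r k"] by (simp add: mass_solution_def less_imp_le)
    have v_eq: "- (1 * laplacian E wt \<mu> (\<lambda>x. u (r k) x / sqrt (m (r k))) x)
        + lam (r k) * h x * (u (r k) x / sqrt (m (r k)))
        = m (r k) powr ((p - 2) / 2) * (u (r k) x / sqrt (m (r k))) powr (p - 1)" for k x
      using mass_solution_rescaled_equation[OF sol m] by simp
    obtain L where L: "(\<lambda>k. lam (r k)) \<longlonglongrightarrow> L"
        "\<And>x. - (1 * laplacian E wt \<mu> v x) + L * h x * v x = 0 * v x powr (p - 1)"
      by (rule multiplier_limit[OF lim v_nonneg _ tendsto_const power v_eq _ z])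
        (use \<open>p > 2\<close> h[of z] in auto)
    have "L \<ge> - c"
      using L(1) by (rule LIMSEQ_le_const) (use lam in blast)
    have eq: "- laplacian E wt \<mu> v x = - L * h x * v x" for x
      using L(2)[of x] by simp
    have "v z > 0"
      using z nonneg[of z] by simp
    then have "- L > 0"
      using eigenvalue_positive[of v z h "- L", OF inf nonneg vanish _ h eq] by simp
    moreover have "0 < V_integral \<mu> (\<lambda>x. h x * (v x)\<^sup>2)"
      by (rule V_integral_pos[where z = z])
        (use mass measure_pos h z in \<open>auto intro!: mult_nonneg_nonneg less_imp_le[OF h]\<close>)
    ultimately show ?thesis
      using eq \<open>L \<ge> - c\<close> by (intro exI[of _ "- L"]) auto
  qed
  show ?thesis
  proof (cases "\<forall>x. v x = 0")
    case True
    with r unif show ?thesis by blast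
  next
    case False
    then have "c \<noteq> 0"
      using eigenvalue by force
    with r unif mass eigenvalue[OF False] show ?thesis by blast
  qed
qed

text \<open>Division by \<open>m k powr ((p - 2) / 2)\<close> sends the coefficient of the Laplacian to zero, so that the
  limit equation couples no two vertices; what converges is the ratio of \<open>lam k\<close> to this power, not
  \<open>lam k\<close> itself.\<close>

lemma large_mass_limit:
  fixes u :: "nat \<Rightarrow> 'v \<Rightarrow> real"
  assumes "p > 2"
    and "\<mu>min > 0" and \<mu>: "\<And>x. \<mu> x \<ge> \<mu>min" and h: "\<And>x. h x > 0"
    and sublevel: "\<And>M. finite {x. h x \<le> M}"
    and m: "\<And>k. m k > 0" and sol: "\<And>k. mass_solution E wt \<mu> p h (m k) (lam k) (u k)"
    and minf: "filterlim m at_top sequentially"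
  shows "\<exists>r w. strict_mono r \<and>
    uniform_limit UNIV (\<lambda>k x. u (r k) x / sqrt (m (r k))) w sequentially \<and>
    ((\<forall>x. w x = 0) \<or>
     (\<exists>lam_inf. V_integrable \<mu> (\<lambda>x. \<bar>w x\<bar> powr p) \<and>
        V_integrable \<mu> (\<lambda>x. h x * (w x)\<^sup>2) \<and>
        V_integral \<mu> (\<lambda>x. h x * (w x)\<^sup>2) \<noteq> 0 \<and>
        lam_inf = V_integral \<mu> (\<lambda>x. \<bar>w x\<bar> powr p) / V_integral \<mu> (\<lambda>x. h x * (w x)\<^sup>2) \<and>
        (\<forall>x. \<bar>w x\<bar> powr (p - 2) * w x = lam_inf * h x * w x)))"
proof -
  obtain r w where r: "strict_mono (r :: nat \<Rightarrow> nat)"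
    and unif: "uniform_limit UNIV (\<lambda>k x. u (r k) x / sqrt (m (r k))) w sequentially"
    and nonneg: "\<And>x. w x \<ge> 0" and "\<And>e. e > 0 \<Longrightarrow> finite {x. w x \<ge> e}"
    and mass: "V_integrable \<mu> (\<lambda>x. h x * (w x)\<^sup>2)" "V_integral \<mu> (\<lambda>x. h x * (w x)\<^sup>2) \<le> 1"
    using normalised_subsequence[of \<mu>min h m p lam u, OF \<open>\<mu>min > 0\<close> \<mu> h sublevel m sol]
    by blast
  have "\<exists>lam_inf. V_integrable \<mu> (\<lambda>x. \<bar>w x\<bar> powr p) \<and>
        V_integral \<mu> (\<lambda>x. h x * (w x)\<^sup>2) \<noteq> 0 \<and>
        lam_inf = V_integral \<mu> (\<lambda>x. \<bar>w x\<bar> powr p) / V_integral \<mu> (\<lambda>x. h x * (w x)\<^sup>2) \<and>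
        (\<forall>x. \<bar>w x\<bar> powr (p - 2) * w x = lam_inf * h x * w x)" if nonzero: "\<not> (\<forall>x. w x = 0)"
  proof -
    obtain z where z: "w z \<noteq> 0"
      using nonzero by blast
    define \<kappa> where "\<kappa> k = m (r k) powr (- ((p - 2) / 2))" for k
    have \<kappa>: "\<kappa> \<longlonglongrightarrow> 0"
      unfolding \<kappa>_def
      by (rule tendsto_neg_powr) (use \<open>p > 2\<close> filterlim_compose[OF minf filterlim_subseq[OF r]] in auto)
    have lim: "(\<lambda>k. u (r k) x / sqrt (m (r k))) \<longlonglongrightarrow> w x" for x
      using tendsto_uniform_limitI[OF unif] by simp
    have v_nonneg: "u (r k) x / sqrt (m (r k)) \<ge> 0" for k x
      using sol[of "r k"] m[of "r k"] by (simp add: mass_solution_def less_imp_le)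
    have v_eq: "- (\<kappa> k * laplacian E wt \<mu> (\<lambda>x. u (r k) x / sqrt (m (r k))) x)
        + (\<kappa> k * lam (r k)) * h x * (u (r k) x / sqrt (m (r k)))
        = 1 * (u (r k) x / sqrt (m (r k))) powr (p - 1)" for k x
    proof -
      have "\<kappa> k * m (r k) powr ((p - 2) / 2) = 1"
        using m[of "r k"] by (simp add: \<kappa>_def flip: powr_add)
      then show ?thesis
        using arg_cong[OF mass_solution_rescaled_equation[OF sol m, of "r k" x],
            where f = "\<lambda>t. \<kappa> k * t"]
        by (simp only: distrib_left mult.assoc[symmetric] mult_minus_right)
    qed
    obtain L where
        "\<And>x. - (0 * laplacian E wt \<mu> w x) + L * h x * w x = 1 * w x powr (p - 1)"
      by (rule multiplier_limit[OF lim v_nonneg _ \<kappa> tendsto_const v_eq _ z])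
        (use \<open>p > 2\<close> h[of z] in auto)
    then have L: "w x powr (p - 1) = L * h x * w x" for x
      by simp
    have eq: "\<bar>w x\<bar> powr (p - 2) * w x = L * h x * w x" for x
      using L[of x] nonneg[of x] powr_mult_base[of "w x" "p - 2"] by (simp add: mult.commute)
    have power: "\<bar>w x\<bar> powr p = L * (h x * (w x)\<^sup>2)" for x
      using L[of x] nonneg[of x] powr_mult_base[of "w x" "p - 1"]
      by (simp add: power2_eq_square mult_ac)
    have pos: "0 < V_integral \<mu> (\<lambda>x. h x * (w x)\<^sup>2)"
      by (rule V_integral_pos[where z = z])
        (use mass measure_pos h z in \<open>auto intro!: mult_nonneg_nonneg less_imp_le[OF h]\<close>)
    have integrable: "V_integrable \<mu> (\<lambda>x. \<bar>w x\<bar> powr p)"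
      using summable_on_cmult_right[OF mass(1)[unfolded V_integrable_def], of L]
      by (simp add: V_integrable_def power mult.left_commute)
    have "V_integral \<mu> (\<lambda>x. \<bar>w x\<bar> powr p) = L * V_integral \<mu> (\<lambda>x. h x * (w x)\<^sup>2)"
      unfolding V_integral_def power by (simp add: mult.left_commute infsum_cmult_right')
    with pos integrable eq show ?thesis
      by (intro exI[of _ L]) auto
  qed
  then show ?thesis
    using r unif mass by (intro exI[of _ r] exI[of _ w]) blast
qed

end

text \<open>A constant multiple of a mass tending to zero cannot stay above the positive number \<open>h x0\<close>.\<close>

lemma mass_condition_excludes_small_masses:
  assumes "m \<longlonglongrightarrow> 0" "h x0 > 0"
  shows "\<not> (\<forall>k. mass_condition E wt \<mu> x0 p h (m k))"
proof
  define K where "K = (2 / p * (\<mu> x0 powr (2 - p / 2) / wdeg E wt x0)) powr (2 / (p - 2))"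
  assume "\<forall>k. mass_condition E wt \<mu> x0 p h (m k)"
  then have "\<exists>N. \<forall>k\<ge>N. h x0 \<le> m k * K"
    by (auto simp: mass_condition_def K_def less_imp_le)
  moreover have "(\<lambda>k. m k * K) \<longlonglongrightarrow> 0"
    using tendsto_mult_right[OF assms(1), of K] by simp
  ultimately have "h x0 \<le> 0"
    by (intro LIMSEQ_le_const)
  with assms(2) show False by simp
qed

section \<open>Asymptotics of normalised solutions\<close>

theorem theorem1p4:
  fixes E :: "'v rel" and wt :: "'v \<Rightarrow> 'v \<Rightarrow> real" and \<mu> h :: "'v \<Rightarrow> real"
    and x0 :: 'v and p c \<mu>min h0 :: real
  assumes "weighted_graph E wt \<mu>"
    and "p > 2"
    and c1: "\<mu>min > 0" "\<And>x. \<mu> x \<ge> \<mu>min"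
    and c2: "bdd_below (range h)" "(INF x. h x) = h0" "h0 > 0"
      "filterlim h at_top (filtercomap (\<lambda>x. graph_dist E x x0) at_top)"
    and "c \<ge> 0"
  shows
    "(\<forall>m u lam.
        (\<forall>k::nat. m k > 0 \<and> mass_condition E wt \<mu> x0 p h (m k) \<and>
          u k \<in> H_space E wt \<mu> h \<and> mass_solution E wt \<mu> p h (m k) (lam k) (u k) \<and> lam k \<ge> - c) \<and>
        m \<longlonglongrightarrow> 0 \<longrightarrow>
        (\<exists>r v. strict_mono r \<and>
          uniform_limit UNIV (\<lambda>k x. u (r k) x / sqrt (m (r k))) v sequentially \<and>
          ((\<forall>x. v x = 0) \<or>
           (\<exists>lam0>0. (\<forall>x. - laplacian E wt \<mu> v x = lam0 * h x * v x) \<and>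
              V_integrable \<mu> (\<lambda>x. h x * (v x)\<^sup>2) \<and>
              0 < V_integral \<mu> (\<lambda>x. h x * (v x)\<^sup>2) \<and>
              V_integral \<mu> (\<lambda>x. h x * (v x)\<^sup>2) \<le> 1)) \<and>
          (c = 0 \<longrightarrow> (\<forall>x. v x = 0)))) \<and>
     (infinite (UNIV :: 'v set) \<longrightarrow> (\<forall>m u lam.
        (\<forall>k::nat. m k > 0 \<and>
          u k \<in> H_space E wt \<mu> h \<and> mass_solution E wt \<mu> p h (m k) (lam k) (u k) \<and> lam k \<ge> - c) \<and>
        m \<longlonglongrightarrow> 0 \<longrightarrow>
        (\<exists>r v. strict_mono r \<and>
          uniform_limit UNIV (\<lambda>k x. u (r k) x / sqrt (m (r k))) v sequentially \<and>
          ((\<forall>x. v x = 0) \<or>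
           (\<exists>lam0>0. (\<forall>x. - laplacian E wt \<mu> v x = lam0 * h x * v x) \<and>
              V_integrable \<mu> (\<lambda>x. h x * (v x)\<^sup>2) \<and>
              0 < V_integral \<mu> (\<lambda>x. h x * (v x)\<^sup>2) \<and>
              V_integral \<mu> (\<lambda>x. h x * (v x)\<^sup>2) \<le> 1)) \<and>
          (c = 0 \<longrightarrow> (\<forall>x. v x = 0))))) \<and>
     (\<forall>m u lam.
        (\<forall>k::nat. m k > 0 \<and> mass_condition E wt \<mu> x0 p h (m k) \<and>
          u k \<in> H_space E wt \<mu> h \<and> mass_solution E wt \<mu> p h (m k) (lam k) (u k) \<and> lam k \<ge> - c) \<and>
        filterlim m at_top sequentially \<longrightarrow>
        (\<exists>r w. strict_mono r \<and>
          uniform_limit UNIV (\<lambda>k x. u (r k) x / sqrt (m (r k))) w sequentially \<and>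
          ((\<forall>x. w x = 0) \<or>
           (\<exists>lam_inf. V_integrable \<mu> (\<lambda>x. \<bar>w x\<bar> powr p) \<and>
              V_integrable \<mu> (\<lambda>x. h x * (w x)\<^sup>2) \<and>
              V_integral \<mu> (\<lambda>x. h x * (w x)\<^sup>2) \<noteq> 0 \<and>
              lam_inf = V_integral \<mu> (\<lambda>x. \<bar>w x\<bar> powr p) / V_integral \<mu> (\<lambda>x. h x * (w x)\<^sup>2) \<and>
              (\<forall>x. \<bar>w x\<bar> powr (p - 2) * w x = lam_inf * h x * w x)))))"
proof -
  interpret weighted_graph E wt \<mu> by fact
  have h: "h x > 0" for x
    using cINF_lower[OF c2(1), of x] c2(2,3) by simp
  note sublevel = finite_sublevel[OF c2(4)]
  show ?thesis
  proof (intro conjI allI impI, goal_cases)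
    case (1 m u lam)
    then have "\<not> (\<forall>k. mass_condition E wt \<mu> x0 p h (m k))"
      by (intro mass_condition_excludes_small_masses h) simp
    with 1 show ?case by blast
  next
    case (2 m u lam)
    then have sol: "m k > 0" "mass_solution E wt \<mu> p h (m k) (lam k) (u k)" "lam k \<ge> - c" for k
      by blast+
    show ?case
      by (rule small_mass_limit[of p \<mu>min h m lam u c, OF 2(1) \<open>p > 2\<close> c1 h sublevel sol])
        (use 2 in simp)
  next
    case (3 m u lam)
    then have sol: "m k > 0" "mass_solution E wt \<mu> p h (m k) (lam k) (u k)" for k
      by blast+
    show ?case
      by (rule large_mass_limit[of p \<mu>min h m lam u, OF \<open>p > 2\<close> c1 h sublevel sol])
        (use 3 in simp)
  qed
qed

end
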